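(* Let $n\ge 2$, let $\mathcal R=\mathbb Z[q^{\pm1},s_1^{\pm1},\dots,s_n^{\pm1}]$, and set $t_i=s_i^2$ for $i=1,\dots,n$. Let $\mathrm{Quant}_n$ and $\mathrm{Gassner}_n$ be the representations of the braid group $\mathcal B_n$ on the free $\mathcal R$-modules $\mathcal R[\mathfrak S_n]\otimes \mathrm{Span}_{\mathcal R}(f_1,\dots,f_n)$ and $\mathcal R[\mathfrak S_n]\otimes \mathrm{Span}_{\mathcal R}(g_1,\dots,g_n)$ defined in the context. Let $\Phi:\mathcal R[\mathfrak S_n]\otimes \mathrm{Span}_{\mathcal R}(f_1,\dots,f_n)\to \mathcal R[\mathfrak S_n]\otimes \mathrm{Span}_{\mathcal R}(g_1,\dots,g_n)$ be the $\mathcal R$-linear map given by $$\Phi(\tau\otimes f_i)=\frac{1-s_{\tau^{-1}(i)}^2}{\prod_{j=i}^{n}s_{\tau^{-1}(j)}}\;\tau\otimes g_i\qquad(\tau\in\mathfrak S_n,\ 1\le i\le n).$$ Then $\Phi$ conjugates $\mathrm{Quant}_n$ to $\mathrm{Gassner}_n$, in the sense that for every braid $\alpha\in\mathcal B_n$, $$\mathrm{Gassner}_n(\alpha)\circ\Phi=\Phi\circ \mathrm{Quant}_n(\alpha).$$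
   Context: $\mathfrak S_n$ is the symmetric group, $(k,k+1)$ a transposition, and products of permutations are compositions of maps, so $((k,k+1)\tau)(x)=(k,k+1)(\tau(x))$. $\mathcal B_n$ is the braid group with standard Artin generators $\sigma_1,\dots,\sigma_{n-1}$. Tensor products are over $\mathcal R$, and $f_1,\dots,f_n$ and $g_1,\dots,g_n$ denote free bases. Gassner representation. For a variable $t$ and $1\le k\le n-1$, let $U_{n,k}(t)$ be the $n\times n$ identity matrix with the $2\times2$ block in rows and columns $k,k+1$ replaced by $\begin{pmatrix}1-t&1\\ t&0\end{pmatrix}$, acting on column vectors in the basis $g_1,\dots,g_n$ (so $g_k\mapsto(1-t)g_k+t\,g_{k+1}$, $g_{k+1}\mapsto g_k$). The representation $\mathrm{Gassner}_n$ is the multiplicative extension to $\mathcal B_n$ of $$\mathrm{Gassner}_n(\sigma_k)(\tau\otimes v)=(k,k+1)\tau\otimes U_{n,k}\bigl(t_{\tau^{-1}(k+1)}\bigr)(v),$$ with $t_i=s_i^2$. Quantum representation. $\mathrm{Quant}_n$ is the colored braid action on the subweight-one weight spaces of tensor products of $n$ Verma modules of quantum $\mathfrak{sl}(2)$ with parameters $s_1,\dots,s_n$ (permuted by $\tau$). The vector $f_i$ corresponds to the tensor product of highest weight vectors $v_0$ in all positions except position $i$, where $v_1$ is inserted. Explicitly, it is the multiplicative extension to $\mathcal B_n$ of $$\mathrm{Quant}_n(\sigma_k)(\tau\otimes f_k)=(1-s_{\tau^{-1}(k)}^2)\,(k,k+1)\tau\otimes f_k+s_{\tau^{-1}(k+1)}\,(k,k+1)\tau\otimes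 f_{k+1},$$ $$\mathrm{Quant}_n(\sigma_k)(\tau\otimes f_{k+1})=s_{\tau^{-1}(k)}\,(k,k+1)\tau\otimes f_k,$$ $$\mathrm{Quant}_n(\sigma_k)(\tau\otimes f_i)=(k,k+1)\tau\otimes f_i\quad (i\ne k,k+1).$$ *)

theory Defs
  imports
    "HOL-Algebra.Sym_Groups"
    "HOL-Algebra.Module"
    "HOL-Algebra.Bij"
    "HOL-Library.Poly_Mapping"
begin

section \<open>The ring of Laurent polynomials\<close>

datatype lvar = Qvar | Svar nat

text \<open>
  A Laurent monomial is a finitely supported family of integer exponents, so the convolution ring
  of finitely supported functions on monomials is the Laurent polynomial ring in
  \<open>q, s\<^sub>0, s\<^sub>1, s\<^sub>2, \<dots>\<close>; the ring attached to \<open>n\<close> is its subring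
  of the elements involving only \<open>q, s\<^sub>1, \<dots>, s\<^sub>n\<close>.
\<close>

type_synonym laurent = "(lvar \<Rightarrow>\<^sub>0 int) \<Rightarrow>\<^sub>0 int"

definition laurent_ring :: "nat \<Rightarrow> laurent ring" where
  "laurent_ring n =
    \<lparr>carrier = {p. \<forall>m \<in> Poly_Mapping.keys p. Poly_Mapping.keys m \<subseteq> insert Qvar (Svar ` {1..n})},
     mult = (*), one = 1, zero = 0, add = (+)\<rparr>"

definition svar :: "nat \<Rightarrow> laurent" where
  "svar i = Poly_Mapping.single (Poly_Mapping.single (Svar i) 1) 1"

definition tvar :: "nat \<Rightarrow> laurent" where
  "tvar i = svar i ^ 2"

section \<open>Free modules and their automorphisms\<close>

text \<open>
  For finite \<open>B\<close>, the free module with basis \<open>B\<close>, elements being coefficient functions.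
  The ring multiplication fields of the record are irrelevant for modules.
\<close>

definition free_module :: "nat \<Rightarrow> 'b set \<Rightarrow> (laurent, 'b \<Rightarrow> laurent) module" where
  "free_module n B =
    \<lparr>carrier = {x. (\<forall>b\<in>B. x b \<in> carrier (laurent_ring n)) \<and> (\<forall>b. b \<notin> B \<longrightarrow> x b = 0)},
     mult = undefined, one = undefined,
     zero = (\<lambda>b. 0), add = (\<lambda>x y b. x b + y b),
     smult = (\<lambda>a x b. a * x b)\<rparr>"

definition basis_vec :: "'b \<Rightarrow> 'b \<Rightarrow> laurent" where
  "basis_vec b = (\<lambda>c. if c = b then 1 else 0)"

definition module_hom ::
  "('a, 'm) ring_scheme \<Rightarrow> ('a, 'b, 'k) module_scheme \<Rightarrow> ('a, 'c, 'l) module_scheme \<Rightarrow> ('b \<Rightarrow> 'c) set"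
  where
  "module_hom R M N = {f \<in> carrier M \<rightarrow>\<^sub>E carrier N.
     (\<forall>x\<in>carrier M. \<forall>y\<in>carrier M. f (x \<oplus>\<^bsub>M\<^esub> y) = f x \<oplus>\<^bsub>N\<^esub> f y) \<and>
     (\<forall>a\<in>carrier R. \<forall>x\<in>carrier M. f (a \<odot>\<^bsub>M\<^esub> x) = a \<odot>\<^bsub>N\<^esub> f x)}"

definition module_aut :: "('a, 'm) ring_scheme \<Rightarrow> ('a, 'b, 'k) module_scheme \<Rightarrow> ('b \<Rightarrow> 'b) monoid" where
  "module_aut R M = BijGroup (carrier M) \<lparr>carrier := module_hom R M M \<inter> Bij (carrier M)\<rparr>"

text \<open>
  The tensor product of the free modules on \<open>A\<close> and \<open>B\<close> is the free module on \<open>A \<times> B\<close>, with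
  pure tensors as follows.
\<close>

definition tensor :: "('a \<Rightarrow> laurent) \<Rightarrow> ('b \<Rightarrow> laurent) \<Rightarrow> 'a \<times> 'b \<Rightarrow> laurent"
  (infixl \<open>\<boxtimes>\<close> 75) where
  "a \<boxtimes> v = (\<lambda>(x, y). a x * v y)"

abbreviation tensor_basis :: "nat \<Rightarrow> ((nat \<Rightarrow> nat) \<times> nat) set" where
  "tensor_basis n \<equiv> carrier (sym_group n) \<times> {1..n}"

text \<open>
  Both tensor products in the theorem are this module: the bases \<open>f\<^sub>i\<close> and \<open>g\<^sub>i\<close> are
  the standard basis \<open>basis_vec i\<close> of the free module of rank \<open>n\<close>, and a permutation \<open>\<tau>\<close> is
  the basis vector \<open>basis_vec \<tau>\<close> of \<open>R[S\<^sub>n]\<close>.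
\<close>

abbreviation tensor_module :: "nat \<Rightarrow> (laurent, (nat \<Rightarrow> nat) \<times> nat \<Rightarrow> laurent) module" where
  "tensor_module n \<equiv> free_module n (tensor_basis n)"

definition linear_extension ::
  "nat \<Rightarrow> ((nat \<Rightarrow> nat) \<Rightarrow> nat \<Rightarrow> (nat \<Rightarrow> nat) \<times> nat \<Rightarrow> laurent) \<Rightarrow>
   ((nat \<Rightarrow> nat) \<times> nat \<Rightarrow> laurent) \<Rightarrow> ((nat \<Rightarrow> nat) \<times> nat \<Rightarrow> laurent)" where
  "linear_extension n \<phi> =
    (\<lambda>x\<in>carrier (tensor_module n). \<lambda>b. \<Sum>(\<tau>, i)\<in>tensor_basis n. x (\<tau>, i) * \<phi> \<tau> i b)"

section \<open>The braid group\<close>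

text \<open>
  Artin's presentation. The letters \<open>(k, True)\<close> and \<open>(k, False)\<close> stand for \<open>\<sigma>\<^sub>k\<close> and its inverse.
\<close>

definition braid_words :: "nat \<Rightarrow> (nat \<times> bool) list set" where
  "braid_words n = lists ({1..<n} \<times> UNIV)"

inductive braid_relator :: "nat \<Rightarrow> (nat \<times> bool) list \<Rightarrow> (nat \<times> bool) list \<Rightarrow> bool" for n where
  free_cancel: "k \<in> {1..<n} \<Longrightarrow> braid_relator n [(k, e), (k, \<not> e)] []"
| far_commute: "i \<in> {1..<n} \<Longrightarrow> j \<in> {1..<n} \<Longrightarrow> i + 2 \<le> j \<Longrightarrow>
    braid_relator n [(i, True), (j, True)] [(j, True), (i, True)]"
| braid_move: "k \<in> {1..<n} \<Longrightarrow> Suc k \<in> {1..<n} \<Longrightarrow>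
    braid_relator n [(k, True), (Suc k, True), (k, True)] [(Suc k, True), (k, True), (Suc k, True)]"

inductive braid_equiv :: "nat \<Rightarrow> (nat \<times> bool) list \<Rightarrow> (nat \<times> bool) list \<Rightarrow> bool" for n where
  equiv_relator: "u \<in> braid_words n \<Longrightarrow> v \<in> braid_words n \<Longrightarrow> braid_relator n r s \<Longrightarrow>
    braid_equiv n (u @ r @ v) (u @ s @ v)"
| equiv_refl: "u \<in> braid_words n \<Longrightarrow> braid_equiv n u u"
| equiv_sym: "braid_equiv n u v \<Longrightarrow> braid_equiv n v u"
| equiv_trans: "braid_equiv n u v \<Longrightarrow> braid_equiv n v w \<Longrightarrow> braid_equiv n u w"

definition braid_rel :: "nat \<Rightarrow> ((nat \<times> bool) list \<times> (nat \<times> bool) list) set" where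
  "braid_rel n = {(u, v). braid_equiv n u v}"

definition braid_group :: "nat \<Rightarrow> (nat \<times> bool) list set monoid" where
  "braid_group n =
    \<lparr>carrier = braid_words n // braid_rel n,
     mult = (\<lambda>A B. \<Union>u\<in>A. \<Union>v\<in>B. braid_rel n `` {u @ v}),
     one = braid_rel n `` {[]}\<rparr>"

definition artin_gen :: "nat \<Rightarrow> nat \<Rightarrow> (nat \<times> bool) list set" where
  "artin_gen n k = braid_rel n `` {[(k, True)]}"

definition eval_word :: "('a, 'm) monoid_scheme \<Rightarrow> (nat \<Rightarrow> 'a) \<Rightarrow> (nat \<times> bool) list \<Rightarrow> 'a" where
  "eval_word G g w =
    foldr (\<lambda>(k, e) y. (if e then g k else inv\<^bsub>G\<^esub> (g k)) \<otimes>\<^bsub>G\<^esub> y) w \<one>\<^bsub>G\<^esub>"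

text \<open>
  The multiplicative extension to the braid group of an assignment \<open>\<sigma>\<^sub>k \<mapsto> g k\<close>: the common value
  of all words representing a braid, provided the \<open>g k\<close> satisfy the braid relations
  (see the locale \<open>braid_action\<close> below).
\<close>

definition braid_extension :: "('a, 'm) monoid_scheme \<Rightarrow> (nat \<Rightarrow> 'a) \<Rightarrow> (nat \<times> bool) list set \<Rightarrow> 'a" where
  "braid_extension G g \<alpha> = the_elem (eval_word G g ` \<alpha>)"

section \<open>The two representations and the intertwiner\<close>

definition quant_gen ::
  "nat \<Rightarrow> nat \<Rightarrow> ((nat \<Rightarrow> nat) \<times> nat \<Rightarrow> laurent) \<Rightarrow> ((nat \<Rightarrow> nat) \<times> nat \<Rightarrow> laurent)" where
  "quant_gen n k = linear_extension n (\<lambda>\<tau> i.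
     let \<tau>' = transpose k (k + 1) \<circ> \<tau> in
     if i = k then
       ((1 - svar (inv' \<tau> k) ^ 2) \<odot>\<^bsub>tensor_module n\<^esub> (basis_vec \<tau>' \<boxtimes> basis_vec k))
         \<oplus>\<^bsub>tensor_module n\<^esub>
       (svar (inv' \<tau> (k + 1)) \<odot>\<^bsub>tensor_module n\<^esub> (basis_vec \<tau>' \<boxtimes> basis_vec (k + 1)))
     else if i = k + 1 then
       svar (inv' \<tau> k) \<odot>\<^bsub>tensor_module n\<^esub> (basis_vec \<tau>' \<boxtimes> basis_vec k)
     else basis_vec \<tau>' \<boxtimes> basis_vec i)"

definition quant ::
  "nat \<Rightarrow> (nat \<times> bool) list set \<Rightarrow>
   ((nat \<Rightarrow> nat) \<times> nat \<Rightarrow> laurent) \<Rightarrow> ((nat \<Rightarrow> nat) \<times> nat \<Rightarrow> laurent)" where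
  "quant n = braid_extension (module_aut (laurent_ring n) (tensor_module n)) (quant_gen n)"

definition U_matrix :: "nat \<Rightarrow> laurent \<Rightarrow> nat \<Rightarrow> nat \<Rightarrow> laurent" where
  "U_matrix k t = (\<lambda>i j.
     if i = k \<and> j = k then 1 - t
     else if i = k \<and> j = k + 1 then 1
     else if i = k + 1 \<and> j = k then t
     else if i = k + 1 \<and> j = k + 1 then 0
     else if i = j then 1 else 0)"

definition apply_matrix :: "nat \<Rightarrow> (nat \<Rightarrow> nat \<Rightarrow> laurent) \<Rightarrow> (nat \<Rightarrow> laurent) \<Rightarrow> nat \<Rightarrow> laurent" where
  "apply_matrix n A v = (\<lambda>i. if i \<in> {1..n} then \<Sum>j = 1..n. A i j * v j else 0)"

definition gassner_gen ::
  "nat \<Rightarrow> nat \<Rightarrow> ((nat \<Rightarrow> nat) \<times> nat \<Rightarrow> laurent) \<Rightarrow> ((nat \<Rightarrow> nat) \<times> nat \<Rightarrow> laurent)" where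
  "gassner_gen n k = linear_extension n (\<lambda>\<tau> i.
     basis_vec (transpose k (k + 1) \<circ> \<tau>) \<boxtimes>
     apply_matrix n (U_matrix k (tvar (inv' \<tau> (k + 1)))) (basis_vec i))"

definition gassner ::
  "nat \<Rightarrow> (nat \<times> bool) list set \<Rightarrow>
   ((nat \<Rightarrow> nat) \<times> nat \<Rightarrow> laurent) \<Rightarrow> ((nat \<Rightarrow> nat) \<times> nat \<Rightarrow> laurent)" where
  "gassner n = braid_extension (module_aut (laurent_ring n) (tensor_module n)) (gassner_gen n)"

definition Phi ::
  "nat \<Rightarrow> ((nat \<Rightarrow> nat) \<times> nat \<Rightarrow> laurent) \<Rightarrow> ((nat \<Rightarrow> nat) \<times> nat \<Rightarrow> laurent)" where
  "Phi n = linear_extension n (\<lambda>\<tau> i.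
     ((1 - svar (inv' \<tau> i) ^ 2) * inv\<^bsub>laurent_ring n\<^esub> (\<Prod>j = i..n. svar (inv' \<tau> j)))
       \<odot>\<^bsub>tensor_module n\<^esub> (basis_vec \<tau> \<boxtimes> basis_vec i))"

section \<open>Well-definedness\<close>

text \<open>
  The objects above are what their definitions claim: the coefficient ring is commutative and
  contains the inverses of the \<open>s\<^sub>i\<close>, and \<open>quant n\<close> and \<open>gassner n\<close> are homomorphisms from the braid
  group to the group of module automorphisms, with the prescribed values on Artin generators.
\<close>

subsection \<open>The coefficient ring\<close>

lemma laurent_ring_simps [simp]:
  "mult (laurent_ring n) = (*)" "one (laurent_ring n) = 1"
  "zero (laurent_ring n) = 0" "add (laurent_ring n) = (+)"
  by (simp_all add: laurent_ring_def)

lemma laurent_carrier_iff: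
  "p \<in> carrier (laurent_ring n) \<longleftrightarrow>
    (\<forall>m\<in>Poly_Mapping.keys p. Poly_Mapping.keys m \<subseteq> insert Qvar (Svar ` {1..n}))"
  by (simp add: laurent_ring_def)

lemma laurent_zero_closed [simp]: "0 \<in> carrier (laurent_ring n)"
  by (simp add: laurent_carrier_iff)

lemma laurent_one_closed [simp]: "1 \<in> carrier (laurent_ring n)"
  by (simp add: laurent_carrier_iff)

lemma laurent_add_closed [simp]:
  "a \<in> carrier (laurent_ring n) \<Longrightarrow> b \<in> carrier (laurent_ring n) \<Longrightarrow> a + b \<in> carrier (laurent_ring n)"
  unfolding laurent_carrier_iff using Poly_Mapping.keys_add[of a b] by blast

lemma laurent_minus_closed [simp]:
  "a \<in> carrier (laurent_ring n) \<Longrightarrow> - a \<in> carrier (laurent_ring n)"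
  unfolding laurent_carrier_iff by simp

lemma laurent_diff_closed [simp]:
  assumes "a \<in> carrier (laurent_ring n)" "b \<in> carrier (laurent_ring n)"
  shows "a - b \<in> carrier (laurent_ring n)"
  using laurent_add_closed[OF assms(1) laurent_minus_closed[OF assms(2)]] by simp

lemma laurent_mult_closed [simp]:
  assumes "a \<in> carrier (laurent_ring n)" "b \<in> carrier (laurent_ring n)"
  shows "a * b \<in> carrier (laurent_ring n)"
  unfolding laurent_carrier_iff
proof
  fix m assume "m \<in> Poly_Mapping.keys (a * b)"
  then obtain u v where uv: "u \<in> Poly_Mapping.keys a" "v \<in> Poly_Mapping.keys b" "m = u + v"
    using keys_mult[of a b] by blast
  then show "Poly_Mapping.keys m \<subseteq> insert Qvar (Svar ` {1..n})"
    using assms Poly_Mapping.keys_add[of u v] unfolding laurent_carrier_iff by blast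
qed

lemma laurent_power_closed [simp]:
  "a \<in> carrier (laurent_ring n) \<Longrightarrow> a ^ k \<in> carrier (laurent_ring n)"
  by (induction k) auto

lemma laurent_sum_closed [simp]:
  "(\<And>x. x \<in> A \<Longrightarrow> h x \<in> carrier (laurent_ring n)) \<Longrightarrow> sum h A \<in> carrier (laurent_ring n)"
  by (induction A rule: infinite_finite_induct) auto

lemma laurent_prod_closed [simp]:
  "(\<And>x. x \<in> A \<Longrightarrow> h x \<in> carrier (laurent_ring n)) \<Longrightarrow> prod h A \<in> carrier (laurent_ring n)"
  by (induction A rule: infinite_finite_induct) auto

lemma laurent_cring: "cring (laurent_ring n)"
proof (rule cringI)
  show "abelian_group (laurent_ring n)"
    by (rule abelian_groupI)
      (auto simp: algebra_simps intro: bexI[of _ "- x" for x])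
  show "comm_monoid (laurent_ring n)"
    by (rule comm_monoidI) (auto simp: algebra_simps)
qed (auto simp: algebra_simps)

definition svar_inv :: "nat \<Rightarrow> laurent" where
  "svar_inv i = Poly_Mapping.single (Poly_Mapping.single (Svar i) (-1)) 1"

lemma svar_mult_inv: "svar i * svar_inv i = 1"
  by (simp add: svar_def svar_inv_def mult_single flip: single_add)

lemma svar_closed [simp]: "i \<in> {1..n} \<Longrightarrow> svar i \<in> carrier (laurent_ring n)"
  by (simp add: svar_def laurent_carrier_iff)

lemma svar_inv_closed [simp]: "i \<in> {1..n} \<Longrightarrow> svar_inv i \<in> carrier (laurent_ring n)"
  by (simp add: svar_inv_def laurent_carrier_iff)

lemma inv_prod_svar:
  assumes "\<And>j. j \<in> J \<Longrightarrow> h j \<in> {1..n}"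
  shows "inv\<^bsub>laurent_ring n\<^esub> (\<Prod>j\<in>J. svar (h j)) = (\<Prod>j\<in>J. svar_inv (h j))"
proof -
  interpret cring "laurent_ring n" by (rule laurent_cring)
  have "(\<Prod>j\<in>J. svar (h j)) * (\<Prod>j\<in>J. svar_inv (h j)) = 1"
    by (simp add: svar_mult_inv flip: prod.distrib)
  then show ?thesis
    using assms by (intro comm_inv_char) auto
qed

subsection \<open>Free modules\<close>

lemma free_module_simps [simp]:
  "zero (free_module n B) = (\<lambda>b. 0)"
  "add (free_module n B) = (\<lambda>x y b. x b + y b)"
  "smult (free_module n B) = (\<lambda>a x b. a * x b)"
  by (simp_all add: free_module_def)

lemma free_module_carrier:
  "x \<in> carrier (free_module n B) \<longleftrightarrow>
    (\<forall>b\<in>B. x b \<in> carrier (laurent_ring n)) \<and> (\<forall>b. b \<notin> B \<longrightarrow> x b = 0)"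
  by (simp add: free_module_def)

lemma free_module_closed:
  assumes "x \<in> carrier (free_module n B)"
  shows "x b \<in> carrier (laurent_ring n)"
  using assms by (cases "b \<in> B") (auto simp: free_module_carrier)

lemma free_module_module: "module (laurent_ring n) (free_module n B)"
proof (rule moduleI)
  show "abelian_group (free_module n B)"
  proof (rule abelian_groupI)
    fix x assume "x \<in> carrier (free_module n B)"
    then show "\<exists>y\<in>carrier (free_module n B). y \<oplus>\<^bsub>free_module n B\<^esub> x = \<zero>\<^bsub>free_module n B\<^esub>"
      by (intro bexI[of _ "\<lambda>b. - x b"]) (auto simp: free_module_carrier)
  qed (auto simp: free_module_carrier algebra_simps)
qed (auto simp: free_module_carrier algebra_simps laurent_cring)

lemma module_aut_group:
  assumes "module R M"
  shows "group (module_aut R M)"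
proof -
  interpret module R M by fact
  have "subgroup (module_hom R M M \<inter> Bij (carrier M)) (BijGroup (carrier M))"
  proof (rule group.subgroupI[OF group_BijGroup])
    have "(\<lambda>x\<in>carrier M. x) \<in> module_hom R M M \<inter> Bij (carrier M)"
      by (auto simp: module_hom_def id_Bij)
    then show "module_hom R M M \<inter> Bij (carrier M) \<noteq> {}" by blast
  next
    fix f assume f: "f \<in> module_hom R M M \<inter> Bij (carrier M)"
    define g where "g = (\<lambda>x\<in>carrier M. inv_into (carrier M) f x)"
    have g: "g \<in> Bij (carrier M)"
      using f unfolding g_def by (intro restrict_inv_into_Bij) auto
    have closed: "g x \<in> carrier M" if "x \<in> carrier M" for x
      using g that Bij_imp_funcset by fastforce
    have fg: "f (g x) = x" if "x \<in> carrier M" for x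
      using f that unfolding g_def by (auto simp: Bij_def bij_betw_def f_inv_into_f)
    have inj: "x = y" if "f x = f y" "x \<in> carrier M" "y \<in> carrier M" for x y
      using f that by (auto simp: Bij_def bij_betw_def inj_on_def)
    have f_add: "f (x \<oplus>\<^bsub>M\<^esub> y) = f x \<oplus>\<^bsub>M\<^esub> f y" if "x \<in> carrier M" "y \<in> carrier M" for x y
      using f that unfolding module_hom_def by blast
    have f_smult: "f (a \<odot>\<^bsub>M\<^esub> x) = a \<odot>\<^bsub>M\<^esub> f x" if "a \<in> carrier R" "x \<in> carrier M" for a x
      using f that unfolding module_hom_def by blast
    have "g \<in> module_hom R M M"
      unfolding module_hom_def
    proof (intro CollectI conjI ballI)
      show "g \<in> carrier M \<rightarrow>\<^sub>E carrier M"
        using closed by (auto simp: g_def PiE_def)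
      show "g (x \<oplus>\<^bsub>M\<^esub> y) = g x \<oplus>\<^bsub>M\<^esub> g y" if "x \<in> carrier M" "y \<in> carrier M" for x y
        by (rule inj) (simp_all add: that closed fg f_add)
      show "g (a \<odot>\<^bsub>M\<^esub> x) = a \<odot>\<^bsub>M\<^esub> g x" if "a \<in> carrier R" "x \<in> carrier M" for a x
        by (rule inj) (simp_all add: that closed fg f_smult)
    qed
    with g show "inv\<^bsub>BijGroup (carrier M)\<^esub> f \<in> module_hom R M M \<inter> Bij (carrier M)"
      using f by (simp add: inv_BijGroup g_def)
  next
    fix f g assume fg: "f \<in> module_hom R M M \<inter> Bij (carrier M)"
      "g \<in> module_hom R M M \<inter> Bij (carrier M)"
    then have "compose (carrier M) f g \<in> module_hom R M M"
      by (auto simp: module_hom_def compose_def PiE_def Pi_def)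
    then show "f \<otimes>\<^bsub>BijGroup (carrier M)\<^esub> g \<in> module_hom R M M \<inter> Bij (carrier M)"
      using fg by (auto simp: BijGroup_def compose_Bij)
  qed (auto simp: BijGroup_def)
  then show ?thesis
    unfolding module_aut_def by (rule group.subgroup_imp_group[OF group_BijGroup])
qed

lemma module_aut_mult:
  assumes "f \<in> carrier (module_aut R M)" "g \<in> carrier (module_aut R M)"
  shows "f \<otimes>\<^bsub>module_aut R M\<^esub> g = compose (carrier M) f g"
  using assms by (simp add: module_aut_def BijGroup_def)

lemma basis_vec_tensor: "basis_vec \<tau> \<boxtimes> basis_vec i = basis_vec (\<tau>, i)"
  by (auto simp: tensor_def basis_vec_def fun_eq_iff)

lemma finite_tensor_basis: "finite (tensor_basis n)"
  by (simp add: sym_group_def finite_permutations)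

lemma linear_extension_tensor:
  assumes "\<tau> \<in> carrier (sym_group n)" "i \<in> {1..n}"
  shows "linear_extension n \<phi> (basis_vec \<tau> \<boxtimes> basis_vec i) = \<phi> \<tau> i"
proof
  fix b
  have "basis_vec \<tau> \<boxtimes> basis_vec i \<in> carrier (tensor_module n)"
    using assms by (auto simp: free_module_carrier basis_vec_tensor) (auto simp: basis_vec_def)
  then have "linear_extension n \<phi> (basis_vec \<tau> \<boxtimes> basis_vec i) b =
      (\<Sum>c\<in>tensor_basis n. if c = (\<tau>, i) then \<phi> (fst c) (snd c) b else 0)"
    unfolding linear_extension_def basis_vec_tensor
    by (auto simp: basis_vec_def case_prod_unfold intro!: sum.cong)
  also have "\<dots> = \<phi> \<tau> i b"
    using assms finite_tensor_basis by (subst sum.delta) auto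
  finally show "linear_extension n \<phi> (basis_vec \<tau> \<boxtimes> basis_vec i) b = \<phi> \<tau> i b" .
qed

lemma linear_extension_hom:
  assumes "\<And>\<tau> i. \<tau> \<in> carrier (sym_group n) \<Longrightarrow> i \<in> {1..n} \<Longrightarrow> \<phi> \<tau> i \<in> carrier (tensor_module n)"
  shows "linear_extension n \<phi> \<in> module_hom (laurent_ring n) (tensor_module n) (tensor_module n)"
proof -
  interpret module "laurent_ring n" "tensor_module n" by (rule free_module_module)
  have closed: "linear_extension n \<phi> x \<in> carrier (tensor_module n)" if "x \<in> carrier (tensor_module n)" for x
    unfolding free_module_carrier
  proof (intro conjI allI impI ballI)
    fix b
    show "linear_extension n \<phi> x b \<in> carrier (laurent_ring n)"
      using that free_module_closed[OF assms, of _ _ b] free_module_closed[OF that]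
      by (auto simp: linear_extension_def intro!: laurent_sum_closed laurent_mult_closed)
    assume "b \<notin> tensor_basis n"
    then have "\<phi> \<tau> i b = 0" if "(\<tau>, i) \<in> tensor_basis n" for \<tau> i
      using assms[of \<tau> i] that unfolding free_module_carrier by blast
    then show "linear_extension n \<phi> x b = 0"
      using that by (auto simp: linear_extension_def intro!: sum.neutral)
  qed
  have add: "(\<lambda>b. x b + y b) \<in> carrier (tensor_module n)"
    if "x \<in> carrier (tensor_module n)" "y \<in> carrier (tensor_module n)" for x y
    using M.a_closed[OF that] by simp
  have smult: "(\<lambda>b. a * x b) \<in> carrier (tensor_module n)"
    if "a \<in> carrier (laurent_ring n)" "x \<in> carrier (tensor_module n)" for a x
    using smult_closed[OF that] by simp
  show ?thesis
    unfolding module_hom_def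
  proof (intro CollectI conjI ballI)
    show "linear_extension n \<phi> \<in> carrier (tensor_module n) \<rightarrow>\<^sub>E carrier (tensor_module n)"
      using closed by (auto simp: linear_extension_def PiE_def)
  next
    fix x y assume "x \<in> carrier (tensor_module n)" "y \<in> carrier (tensor_module n)"
    then show "linear_extension n \<phi> (x \<oplus>\<^bsub>tensor_module n\<^esub> y) =
        linear_extension n \<phi> x \<oplus>\<^bsub>tensor_module n\<^esub> linear_extension n \<phi> y"
      by (simp add: linear_extension_def add[simplified] distrib_right sum.distrib case_prod_unfold)
  next
    fix a x assume "a \<in> carrier (laurent_ring n)" "x \<in> carrier (tensor_module n)"
    then show "linear_extension n \<phi> (a \<odot>\<^bsub>tensor_module n\<^esub> x) =
        a \<odot>\<^bsub>tensor_module n\<^esub> linear_extension n \<phi> x"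
      by (simp add: linear_extension_def smult[simplified] sum_distrib_left case_prod_unfold mult.assoc)
  qed
qed

subsection \<open>The braid group\<close>

lemma braid_words_simps [simp]:
  "[] \<in> braid_words n"
  "(k, e) # w \<in> braid_words n \<longleftrightarrow> k \<in> {1..<n} \<and> w \<in> braid_words n"
  "u @ v \<in> braid_words n \<longleftrightarrow> u \<in> braid_words n \<and> v \<in> braid_words n"
  by (auto simp: braid_words_def)

lemma braid_relator_words:
  "braid_relator n r s \<Longrightarrow> r \<in> braid_words n \<and> s \<in> braid_words n"
  by (induction rule: braid_relator.induct) auto

lemma braid_equiv_words:
  "braid_equiv n u v \<Longrightarrow> u \<in> braid_words n \<and> v \<in> braid_words n"
  by (induction rule: braid_equiv.induct) (auto dest: braid_relator_words)

lemma braid_equiv_append_left: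
  "braid_equiv n u v \<Longrightarrow> w \<in> braid_words n \<Longrightarrow> braid_equiv n (w @ u) (w @ v)"
proof (induction rule: braid_equiv.induct)
  case (equiv_relator u v r s)
  then show ?case using braid_equiv.equiv_relator[of "w @ u" n v r s] by simp
qed (auto intro: braid_equiv.intros)

lemma braid_equiv_append_right:
  "braid_equiv n u v \<Longrightarrow> w \<in> braid_words n \<Longrightarrow> braid_equiv n (u @ w) (v @ w)"
proof (induction rule: braid_equiv.induct)
  case (equiv_relator u v r s)
  then show ?case using braid_equiv.equiv_relator[of u n "v @ w" r s] by simp
qed (auto intro: braid_equiv.intros)

lemma braid_equiv_append:
  assumes "braid_equiv n u u'" "braid_equiv n v v'"
  shows "braid_equiv n (u @ v) (u' @ v')"
  using assms braid_equiv_append_left[OF assms(2)] braid_equiv_append_right[OF assms(1)]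
    braid_equiv_words braid_equiv.equiv_trans by blast

lemma equiv_braid_rel: "equiv (braid_words n) (braid_rel n)"
  by (rule equivI)
    (auto simp: refl_on_def sym_def trans_def braid_rel_def dest: braid_equiv_words
      intro: braid_equiv.intros)

lemma braid_group_one: "\<one>\<^bsub>braid_group n\<^esub> = braid_rel n `` {[]}"
  by (simp add: braid_group_def)

lemma braid_group_mult:
  assumes "u \<in> braid_words n" "v \<in> braid_words n"
  shows "(braid_rel n `` {u}) \<otimes>\<^bsub>braid_group n\<^esub> (braid_rel n `` {v}) = braid_rel n `` {u @ v}"
proof -
  have "(\<lambda>u v. braid_rel n `` {u @ v}) respects2 braid_rel n"
    by (rule congruent2I'; rule equiv_class_eq[OF equiv_braid_rel])
      (simp add: braid_rel_def braid_equiv_append)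
  then show ?thesis
    using UN_equiv_class2[OF equiv_braid_rel equiv_braid_rel _ assms]
    by (simp add: braid_group_def)
qed

lemma braid_group_carrierE:
  assumes "\<alpha> \<in> carrier (braid_group n)"
  obtains w where "w \<in> braid_words n" "\<alpha> = braid_rel n `` {w}"
  using assms by (auto simp: braid_group_def elim: quotientE)

lemma braid_group_class:
  "w \<in> braid_words n \<Longrightarrow> braid_rel n `` {w} \<in> carrier (braid_group n)"
  by (simp add: braid_group_def quotientI)

lemma braid_class_eq:
  "braid_equiv n u v \<Longrightarrow> braid_rel n `` {u} = braid_rel n `` {v}"
  by (rule equiv_class_eq[OF equiv_braid_rel]) (simp add: braid_rel_def)

lemma braid_word_inverse:
  "w \<in> braid_words n \<Longrightarrow> \<exists>v\<in>braid_words n. braid_equiv n (v @ w) []"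
proof (induction w)
  case Nil
  then show ?case by (intro bexI[of _ "[]"]) (auto intro: braid_equiv.intros)
next
  case (Cons l w)
  obtain k e where l: "l = (k, e)" by (cases l)
  with Cons obtain v where v: "v \<in> braid_words n" "braid_equiv n (v @ w) []" and k: "k \<in> {1..<n}"
    and w: "w \<in> braid_words n" by auto
  have "braid_equiv n (v @ [(k, \<not> e), (k, \<not> \<not> e)] @ w) (v @ [] @ w)"
    by (rule braid_equiv.equiv_relator[OF v(1) w braid_relator.free_cancel[OF k]])
  then have "braid_equiv n ((v @ [(k, \<not> e)]) @ (l # w)) []"
    using braid_equiv.equiv_trans[OF _ v(2)] l by simp
  then show ?case using v k by (intro bexI[of _ "v @ [(k, \<not> e)]"]) auto
qed

lemma braid_group_group: "group (braid_group n)"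
proof (rule groupI)
  fix x assume "x \<in> carrier (braid_group n)"
  then obtain w where w: "w \<in> braid_words n" "x = braid_rel n `` {w}"
    by (rule braid_group_carrierE)
  then obtain v where "v \<in> braid_words n" "braid_equiv n (v @ w) []"
    using braid_word_inverse by blast
  then show "\<exists>y\<in>carrier (braid_group n). y \<otimes>\<^bsub>braid_group n\<^esub> x = \<one>\<^bsub>braid_group n\<^esub>"
    using w by (intro bexI[of _ "braid_rel n `` {v}"])
      (simp_all add: braid_group_mult braid_group_one braid_group_class braid_class_eq)
next
  fix x y assume "x \<in> carrier (braid_group n)" "y \<in> carrier (braid_group n)"
  then obtain u v where uv: "u \<in> braid_words n" "x = braid_rel n `` {u}"
    "v \<in> braid_words n" "y = braid_rel n `` {v}"
    by (meson braid_group_carrierE)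
  then show "x \<otimes>\<^bsub>braid_group n\<^esub> y \<in> carrier (braid_group n)"
    by (simp add: braid_group_mult braid_group_class)
  fix z assume "z \<in> carrier (braid_group n)"
  then obtain w where "w \<in> braid_words n" "z = braid_rel n `` {w}"
    by (rule braid_group_carrierE)
  with uv show "x \<otimes>\<^bsub>braid_group n\<^esub> y \<otimes>\<^bsub>braid_group n\<^esub> z =
      x \<otimes>\<^bsub>braid_group n\<^esub> (y \<otimes>\<^bsub>braid_group n\<^esub> z)"
    by (simp add: braid_group_mult)
next
  fix x assume "x \<in> carrier (braid_group n)"
  then obtain w where "w \<in> braid_words n" "x = braid_rel n `` {w}"
    by (rule braid_group_carrierE)
  then show "\<one>\<^bsub>braid_group n\<^esub> \<otimes>\<^bsub>braid_group n\<^esub> x = x"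
    by (simp add: braid_group_mult braid_group_one)
qed (simp add: braid_group_one braid_group_class)

lemma eval_word_simps [simp]:
  "eval_word G g [] = \<one>\<^bsub>G\<^esub>"
  "eval_word G g ((k, e) # w) = (if e then g k else inv\<^bsub>G\<^esub> (g k)) \<otimes>\<^bsub>G\<^esub> eval_word G g w"
  by (simp_all add: eval_word_def)

locale braid_action = group G for G :: "('a, 'm) monoid_scheme" (structure) +
  fixes n :: nat and g :: "nat \<Rightarrow> 'a"
  assumes closed: "k \<in> {1..<n} \<Longrightarrow> g k \<in> carrier G"
    and far: "i \<in> {1..<n} \<Longrightarrow> j \<in> {1..<n} \<Longrightarrow> i + 2 \<le> j \<Longrightarrow> g i \<otimes> g j = g j \<otimes> g i"
    and braid: "k \<in> {1..<n} \<Longrightarrow> Suc k \<in> {1..<n} \<Longrightarrow>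
      g k \<otimes> g (Suc k) \<otimes> g k = g (Suc k) \<otimes> g k \<otimes> g (Suc k)"
begin

lemma eval_closed: "w \<in> braid_words n \<Longrightarrow> eval_word G g w \<in> carrier G"
proof (induction w)
  case (Cons l w)
  then show ?case by (cases l) (auto simp: closed)
qed simp

lemma eval_append:
  "u \<in> braid_words n \<Longrightarrow> v \<in> braid_words n \<Longrightarrow>
    eval_word G g (u @ v) = eval_word G g u \<otimes> eval_word G g v"
proof (induction u)
  case (Cons l u)
  then show ?case by (cases l) (auto simp: closed eval_closed m_assoc)
qed (simp add: eval_closed)

lemma eval_relator: "braid_relator n r s \<Longrightarrow> eval_word G g r = eval_word G g s"
proof (induction rule: braid_relator.induct)
  case (free_cancel k e)
  then show ?case by (simp add: closed del: atLeastLessThan_iff)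
next
  case (far_commute i j)
  then show ?case using braid_action.far[OF braid_action_axioms far_commute]
    by (simp add: closed del: atLeastLessThan_iff)
next
  case (braid_move k)
  then show ?case using braid_action.braid[OF braid_action_axioms braid_move]
    by (simp add: closed m_assoc del: atLeastLessThan_iff)
qed

lemma eval_equiv: "braid_equiv n u v \<Longrightarrow> eval_word G g u = eval_word G g v"
proof (induction rule: braid_equiv.induct)
  case (equiv_relator u v r s)
  then show ?case
    using braid_relator_words[OF equiv_relator(3)] by (simp add: eval_append eval_relator)
qed auto

lemma extension_class:
  assumes "w \<in> braid_words n"
  shows "braid_extension G g (braid_rel n `` {w}) = eval_word G g w"
proof -
  have "eval_word G g ` (braid_rel n `` {w}) = {eval_word G g w}"
    using assms braid_equiv.equiv_refl[of w n] by (auto simp: braid_rel_def dest: eval_equiv)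
  then show ?thesis by (simp add: braid_extension_def)
qed

lemma braid_extension_hom: "braid_extension G g \<in> hom (braid_group n) G"
proof (rule homI)
  fix x assume "x \<in> carrier (braid_group n)"
  then obtain u where u: "u \<in> braid_words n" "x = braid_rel n `` {u}"
    by (rule braid_group_carrierE)
  then show "braid_extension G g x \<in> carrier G"
    by (simp add: extension_class eval_closed)
  fix y assume "y \<in> carrier (braid_group n)"
  then obtain v where "v \<in> braid_words n" "y = braid_rel n `` {v}"
    by (rule braid_group_carrierE)
  with u show "braid_extension G g (x \<otimes>\<^bsub>braid_group n\<^esub> y) =
      braid_extension G g x \<otimes> braid_extension G g y"
    by (simp add: braid_group_mult extension_class eval_append)
qed

lemma braid_extension_gen:
  assumes "k \<in> {1..<n}"
  shows "braid_extension G g (artin_gen n k) = g k"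
  using assms by (simp add: artin_gen_def extension_class closed)

end

subsection \<open>The representations\<close>

lemma transpose_sym_group:
  assumes "k \<in> {1..<n}"
  shows "transpose k (k + 1) \<circ> \<tau> \<in> carrier (sym_group n) \<longleftrightarrow> \<tau> \<in> carrier (sym_group n)"
proof -
  have "transpose k (k + 1) permutes {1..n}"
    using assms by (intro permutes_swap_id) auto
  from permutes_compose[OF _ this]
  have "transpose k (k + 1) \<circ> \<sigma> \<in> carrier (sym_group n)" if "\<sigma> \<in> carrier (sym_group n)" for \<sigma>
    using that by (simp add: sym_group_carrier)
  from this[of \<tau>] this[of "transpose k (k + 1) \<circ> \<tau>"] show ?thesis
    by (auto simp flip: comp_assoc)
qed

lemma inv_transpose_comp:
  assumes "\<tau> \<in> carrier (sym_group n)"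
  shows "inv' (transpose a b \<circ> \<tau>) m = inv' \<tau> (transpose a b m)"
proof -
  have "bij \<tau>" using assms by (simp add: sym_group_carrier permutes_bij)
  then show ?thesis by (simp add: o_inv_distrib)
qed

lemma inv_sym_group_mem:
  "\<tau> \<in> carrier (sym_group n) \<Longrightarrow> j \<in> {1..n} \<Longrightarrow> inv' \<tau> j \<in> {1..n}"
  by (simp only: sym_group_carrier permutes_in_image[OF permutes_inv])

definition local_matrix :: "nat \<Rightarrow> laurent \<Rightarrow> laurent \<Rightarrow> laurent \<Rightarrow> nat \<Rightarrow> nat \<Rightarrow> laurent" where
  "local_matrix k p q r i j =
     (if i = k \<and> j = k then p else if i = k \<and> j = k + 1 then q
      else if i = k + 1 \<and> j = k then r else if i = k + 1 \<and> j = k + 1 then 0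
      else if i = j then 1 else 0)"

lemma local_matrix_sum:
  assumes "k \<in> {1..<n}" "i \<in> {1..n}"
  shows "(\<Sum>j = 1..n. y j * local_matrix k p q r i j) =
    (if i = k then p * y k + q * y (k + 1) else if i = k + 1 then r * y k else y i)"
proof -
  have "(\<Sum>j = 1..n. y j * local_matrix k p q r i j) =
      (\<Sum>j\<in>{k, k + 1, i}. y j * local_matrix k p q r i j)"
    using assms by (intro sum.mono_neutral_right) (auto simp: local_matrix_def)
  also have "\<dots> = (if i = k then p * y k + q * y (k + 1) else if i = k + 1 then r * y k else y i)"
    by (auto simp: local_matrix_def insert_commute algebra_simps)
  finally show ?thesis .
qed

locale local_operator =
  fixes n k :: nat and F and P Q R Q' R' :: "(nat \<Rightarrow> nat) \<Rightarrow> laurent" and \<phi>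
  assumes k: "k \<in> {1..<n}"
    and F: "F = linear_extension n \<phi>"
    and \<phi>: "\<And>\<tau> j b. \<tau> \<in> carrier (sym_group n) \<Longrightarrow> j \<in> {1..n} \<Longrightarrow>
      \<phi> \<tau> j b = (if fst b = transpose k (k + 1) \<circ> \<tau> \<and> snd b \<in> {1..n}
        then local_matrix k (P \<tau>) (Q \<tau>) (R \<tau>) (snd b) j else 0)"
    and closed: "\<And>\<tau>. \<tau> \<in> carrier (sym_group n) \<Longrightarrow>
      P \<tau> \<in> carrier (laurent_ring n) \<and> Q \<tau> \<in> carrier (laurent_ring n) \<and> R \<tau> \<in> carrier (laurent_ring n)
      \<and> Q' \<tau> \<in> carrier (laurent_ring n) \<and> R' \<tau> \<in> carrier (laurent_ring n)"
    and units: "\<And>\<tau>. Q \<tau> * Q' \<tau> = 1" "\<And>\<tau>. R \<tau> * R' \<tau> = 1"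
begin

lemma hom: "F \<in> module_hom (laurent_ring n) (tensor_module n) (tensor_module n)"
  unfolding F
proof (rule linear_extension_hom)
  fix \<tau> i assume *: "\<tau> \<in> carrier (sym_group n)" "i \<in> {1..n}"
  then show "\<phi> \<tau> i \<in> carrier (tensor_module n)"
    using closed[OF *(1)] k by (auto simp: free_module_carrier \<phi>[OF *] transpose_sym_group[OF k, simplified] local_matrix_def)
qed

lemma F_closed: "x \<in> carrier (tensor_module n) \<Longrightarrow> F x \<in> carrier (tensor_module n)"
  using hom unfolding module_hom_def by blast

lemma outside:
  assumes "x \<in> carrier (tensor_module n)" "\<pi> \<notin> carrier (sym_group n) \<or> i \<notin> {1..n}"
  shows "x (\<pi>, i) = 0"
  using assms unfolding free_module_carrier by blast

lemma F_apply:
  assumes x: "x \<in> carrier (tensor_module n)"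
  shows "F x (\<pi>, i) =
    (if i = k then P (transpose k (k + 1) \<circ> \<pi>) * x (transpose k (k + 1) \<circ> \<pi>, k)
        + Q (transpose k (k + 1) \<circ> \<pi>) * x (transpose k (k + 1) \<circ> \<pi>, k + 1)
     else if i = k + 1 then R (transpose k (k + 1) \<circ> \<pi>) * x (transpose k (k + 1) \<circ> \<pi>, k)
     else x (transpose k (k + 1) \<circ> \<pi>, i))"
proof (cases "\<pi> \<in> carrier (sym_group n) \<and> i \<in> {1..n}")
  case False
  then have "F x (\<pi>, i) = 0"
    using outside[OF F_closed[OF x]] by blast
  moreover have "x (transpose k (k + 1) \<circ> \<pi>, j) = 0" if "\<pi> \<notin> carrier (sym_group n) \<or> j \<notin> {1..n}" for j
    using outside[OF x] that transpose_sym_group[OF k] by blast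
  moreover have "k \<in> {1..n}" "k + 1 \<in> {1..n}" using k by auto
  ultimately show ?thesis using False by auto
next
  case True
  let ?\<tau> = "transpose k (k + 1) \<circ> \<pi>"
  have \<tau>: "?\<tau> \<in> carrier (sym_group n)" using True transpose_sym_group[OF k] by blast
  have eq: "\<pi> = transpose k (k + 1) \<circ> \<tau> \<longleftrightarrow> \<tau> = ?\<tau>" for \<tau>
    by (auto simp flip: comp_assoc)
  have "F x (\<pi>, i) = (\<Sum>\<tau>\<in>carrier (sym_group n). \<Sum>j = 1..n. x (\<tau>, j) * \<phi> \<tau> j (\<pi>, i))"
    using x by (simp add: F linear_extension_def sum.cartesian_product case_prod_unfold)
  also have "\<dots> = (\<Sum>\<tau>\<in>carrier (sym_group n). if \<tau> = ?\<tau> then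
      \<Sum>j = 1..n. x (?\<tau>, j) * local_matrix k (P ?\<tau>) (Q ?\<tau>) (R ?\<tau>) i j else 0)"
  proof (rule sum.cong[OF refl])
    fix \<tau> assume "\<tau> \<in> carrier (sym_group n)"
    then show "(\<Sum>j = 1..n. x (\<tau>, j) * \<phi> \<tau> j (\<pi>, i)) = (if \<tau> = ?\<tau> then
      \<Sum>j = 1..n. x (?\<tau>, j) * local_matrix k (P ?\<tau>) (Q ?\<tau>) (R ?\<tau>) i j else 0)"
      using True by (auto simp: \<phi> eq[simplified] intro!: sum.neutral)
  qed
  also have "\<dots> = (\<Sum>j = 1..n. x (?\<tau>, j) * local_matrix k (P ?\<tau>) (Q ?\<tau>) (R ?\<tau>) i j)"
    using \<tau> by (subst sum.delta) (simp_all add: sym_group_def finite_permutations)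
  finally show ?thesis
    using True by (subst (asm) local_matrix_sum[OF k]) auto
qed

lemma bij: "bij_betw F (carrier (tensor_module n)) (carrier (tensor_module n))"
proof -
  let ?s = "\<lambda>\<tau>. transpose k (k + 1) \<circ> \<tau>"
  define G where "G y = (\<lambda>(\<tau>, i). if i = k then R' \<tau> * y (?s \<tau>, k + 1)
    else if i = k + 1 then Q' \<tau> * (y (?s \<tau>, k) - P \<tau> * (R' \<tau> * y (?s \<tau>, k + 1)))
    else y (?s \<tau>, i))" for y :: "(nat \<Rightarrow> nat) \<times> nat \<Rightarrow> laurent"
  have ss: "?s (?s \<tau>) = \<tau>" for \<tau> :: "nat \<Rightarrow> nat"
    by (simp flip: comp_assoc)
  have G: "G y \<in> carrier (tensor_module n)" if y: "y \<in> carrier (tensor_module n)" for y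
    unfolding free_module_carrier
  proof (intro conjI ballI allI impI)
    fix b assume "b \<in> tensor_basis n"
    then show "G y b \<in> carrier (laurent_ring n)"
      using closed[of "fst b"] free_module_closed[OF y] by (auto simp: G_def)
  next
    fix b assume "b \<notin> tensor_basis n"
    then have *: "fst b \<notin> carrier (sym_group n) \<or> snd b \<notin> {1..n}" by (cases b) auto
    have "y (?s \<tau>, j) = 0" if "\<tau> \<notin> carrier (sym_group n) \<or> j \<notin> {1..n}" for \<tau> j
      using outside[OF y] that transpose_sym_group[OF k] by blast
    moreover have "k \<in> {1..n}" "k + 1 \<in> {1..n}" using k by auto
    ultimately show "G y b = 0"
      using * by (cases b) (auto simp: G_def)
  qed
  have u: "Q' \<tau> * (Q \<tau> * z) = z" "R' \<tau> * (R \<tau> * z) = z" "Q \<tau> * (Q' \<tau> * z) = z" "R \<tau> * (R' \<tau> * z) = z" for \<tau> z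
    by (metis units mult.assoc mult.commute mult_1_left)+
  show ?thesis
  proof (rule bij_betw_byWitness[where f' = G])
    show "\<forall>x\<in>carrier (tensor_module n). G (F x) = x"
    proof (intro ballI ext, clarify)
      fix x \<tau> i assume x: "x \<in> carrier (tensor_module n)"
      show "G (F x) (\<tau>, i) = x (\<tau>, i)"
        by (simp add: G_def F_apply[OF x] ss[simplified] u)
    qed
    show "\<forall>x\<in>carrier (tensor_module n). F (G x) = x"
    proof (intro ballI ext, clarify)
      fix x \<tau> i assume x: "x \<in> carrier (tensor_module n)"
      show "F (G x) (\<tau>, i) = x (\<tau>, i)"
        unfolding F_apply[OF G[OF x]] by (simp add: G_def ss[simplified] u)
    qed
  qed (use G F_closed in auto)
qed

lemma aut: "F \<in> carrier (module_aut (laurent_ring n) (tensor_module n))"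
  using hom bij by (simp add: module_aut_def Bij_def F linear_extension_def)

end

lemma quant_gen_local:
  assumes k: "k \<in> {1..<n}"
  shows "local_operator n k (quant_gen n k)
    (\<lambda>\<tau>. 1 - svar (inv' \<tau> k) ^ 2) (\<lambda>\<tau>. svar (inv' \<tau> k)) (\<lambda>\<tau>. svar (inv' \<tau> (k + 1)))
    (\<lambda>\<tau>. svar_inv (inv' \<tau> k)) (\<lambda>\<tau>. svar_inv (inv' \<tau> (k + 1)))
    (\<lambda>\<tau> i.
     let \<tau>' = transpose k (k + 1) \<circ> \<tau> in
     if i = k then
       ((1 - svar (inv' \<tau> k) ^ 2) \<odot>\<^bsub>tensor_module n\<^esub> (basis_vec \<tau>' \<boxtimes> basis_vec k))
         \<oplus>\<^bsub>tensor_module n\<^esub>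
       (svar (inv' \<tau> (k + 1)) \<odot>\<^bsub>tensor_module n\<^esub> (basis_vec \<tau>' \<boxtimes> basis_vec (k + 1)))
     else if i = k + 1 then
       svar (inv' \<tau> k) \<odot>\<^bsub>tensor_module n\<^esub> (basis_vec \<tau>' \<boxtimes> basis_vec k)
     else basis_vec \<tau>' \<boxtimes> basis_vec i)"
proof (unfold_locales, goal_cases)
  case (4 \<tau>)
  have "inv' \<tau> k \<in> {1..n}" "inv' \<tau> (k + 1) \<in> {1..n}"
    using k by (auto intro!: inv_sym_group_mem[OF 4, simplified])
  then show ?case by simp
next
  case (3 \<tau> j b)
  then show ?case
    using k by (cases b) (auto simp: Let_def basis_vec_def tensor_def local_matrix_def)
qed (use k in \<open>simp_all add: quant_gen_def svar_mult_inv\<close>)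

lemma gassner_gen_local:
  assumes k: "k \<in> {1..<n}"
  shows "local_operator n k (gassner_gen n k)
    (\<lambda>\<tau>. 1 - tvar (inv' \<tau> (k + 1))) (\<lambda>\<tau>. 1) (\<lambda>\<tau>. tvar (inv' \<tau> (k + 1)))
    (\<lambda>\<tau>. 1) (\<lambda>\<tau>. svar_inv (inv' \<tau> (k + 1)) ^ 2)
    (\<lambda>\<tau> i. basis_vec (transpose k (k + 1) \<circ> \<tau>) \<boxtimes>
       apply_matrix n (U_matrix k (tvar (inv' \<tau> (k + 1)))) (basis_vec i))"
proof (unfold_locales, goal_cases)
  case (4 \<tau>)
  have "inv' \<tau> (k + 1) \<in> {1..n}"
    using k by (intro inv_sym_group_mem[OF 4]) auto
  then show ?case by (simp add: tvar_def)
next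
  case (3 \<tau> j b)
  have "(\<Sum>j' = 1..n. A j' * basis_vec j j') = A j" for A
  proof -
    have "(\<Sum>j' = 1..n. A j' * basis_vec j j') = (\<Sum>j' = 1..n. if j' = j then A j' else 0)"
      by (intro sum.cong) (auto simp: basis_vec_def)
    then show ?thesis using 3 by simp
  qed
  then show ?case
    by (cases b) (auto simp: basis_vec_def[of "_ \<circ> _"] tensor_def local_matrix_def U_matrix_def apply_matrix_def)
qed (use k in \<open>simp_all add: gassner_gen_def tvar_def svar_mult_inv flip: power_mult_distrib\<close>)

lemma module_aut_eqI:
  assumes "f \<in> carrier (module_aut (laurent_ring n) (tensor_module n))"
    and "g \<in> carrier (module_aut (laurent_ring n) (tensor_module n))"
    and "\<And>x \<tau> i. x \<in> carrier (tensor_module n) \<Longrightarrow> \<tau> \<in> carrier (sym_group n) \<Longrightarrow> f x (\<tau>, i) = g x (\<tau>, i)"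
  shows "f = g"
proof
  fix x
  show "f x = g x"
  proof (cases "x \<in> carrier (tensor_module n)")
    case True
    then have closed: "f x \<in> carrier (tensor_module n)" "g x \<in> carrier (tensor_module n)"
      using assms(1,2) by (auto simp: module_aut_def module_hom_def)
    have "f x (\<tau>, i) = g x (\<tau>, i)" for \<tau> i
    proof (cases "\<tau> \<in> carrier (sym_group n)")
      case False
      then have "(\<tau>, i) \<notin> tensor_basis n" by simp
      then show ?thesis using closed unfolding free_module_carrier by metis
    qed (use assms(3) True in blast)
    then show ?thesis by (simp add: fun_eq_iff)
  next
    case False
    moreover have "f \<in> extensional (carrier (tensor_module n))" "g \<in> extensional (carrier (tensor_module n))"
      using assms(1,2) by (auto simp: module_aut_def Bij_def)
    ultimately show ?thesis unfolding extensional_def by auto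
  qed
qed

lemma transpose_far:
  fixes i j :: nat
  assumes "i + 2 \<le> j"
  shows "transpose i (i + 1) \<circ> (transpose j (j + 1) \<circ> \<tau>) = transpose j (j + 1) \<circ> (transpose i (i + 1) \<circ> \<tau>)"
  using assms by (auto simp: fun_eq_iff transpose_def)

lemma transpose_braid:
  fixes k :: nat
  shows "transpose k (k + 1) \<circ> (transpose (Suc k) (Suc k + 1) \<circ> (transpose k (k + 1) \<circ> \<tau>)) =
    transpose (Suc k) (Suc k + 1) \<circ> (transpose k (k + 1) \<circ> (transpose (Suc k) (Suc k + 1) \<circ> \<tau>))"
  by (auto simp: fun_eq_iff transpose_def)

lemma module_aut_apply_mult:
  assumes "f \<in> carrier (module_aut R M)" "g \<in> carrier (module_aut R M)" "x \<in> carrier M"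
  shows "(f \<otimes>\<^bsub>module_aut R M\<^esub> g) x = f (g x)"
  using assms by (simp add: module_aut_mult compose_def)

lemma quant_braid_action:
  "braid_action (module_aut (laurent_ring n) (tensor_module n)) n (quant_gen n)"
proof -
  let ?G = "module_aut (laurent_ring n) (tensor_module n)"
  interpret G: group ?G by (intro module_aut_group free_module_module)
  note aut = local_operator.aut[OF quant_gen_local]
  note ap = local_operator.F_apply[OF quant_gen_local]
  note cl = local_operator.F_closed[OF quant_gen_local]
  show ?thesis
  proof (unfold_locales, goal_cases)
    case (1 k)
    then show ?case by (rule aut)
  next
    case (2 i j)
    note [simp] = aut[OF 2(1)] aut[OF 2(2)]
    show ?case
    proof (rule module_aut_eqI)
      fix x \<tau> l assume x: "x \<in> carrier (tensor_module n)" and \<tau>: "\<tau> \<in> carrier (sym_group n)"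
      note [simp] = transpose_sym_group[OF 2(1)] transpose_sym_group[OF 2(2)]
      show "(quant_gen n i \<otimes>\<^bsub>?G\<^esub> quant_gen n j) x (\<tau>, l) = (quant_gen n j \<otimes>\<^bsub>?G\<^esub> quant_gen n i) x (\<tau>, l)"
        using 2(3) \<tau>
        by (simp del: One_nat_def add_Suc_right add: module_aut_apply_mult x cl[OF 2(1)] cl[OF 2(2)]
              ap[OF 2(1)] ap[OF 2(2)] inv_transpose_comp[of _ n] transpose_far[OF 2(3)] transpose_def[of _ _ "_ :: nat"])
    qed (intro G.m_closed aut 2)+
  next
    case (3 k)
    note [simp] = aut[OF 3(1)] aut[OF 3(2)]
    show ?case
    proof (rule module_aut_eqI)
      fix x \<tau> l assume x: "x \<in> carrier (tensor_module n)" and \<tau>: "\<tau> \<in> carrier (sym_group n)"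
      note [simp] = transpose_sym_group[OF 3(1), folded Suc_eq_plus1] transpose_sym_group[OF 3(2), folded Suc_eq_plus1]
      show "(quant_gen n k \<otimes>\<^bsub>?G\<^esub> quant_gen n (Suc k) \<otimes>\<^bsub>?G\<^esub> quant_gen n k) x (\<tau>, l) =
        (quant_gen n (Suc k) \<otimes>\<^bsub>?G\<^esub> quant_gen n k \<otimes>\<^bsub>?G\<^esub> quant_gen n (Suc k)) x (\<tau>, l)"
        using \<tau>
        by (simp del: One_nat_def add_Suc_right add: module_aut_apply_mult x cl[OF 3(1)] cl[OF 3(2)]
              ap[OF 3(1), folded Suc_eq_plus1] ap[OF 3(2), folded Suc_eq_plus1] inv_transpose_comp[of _ n] transpose_braid[folded Suc_eq_plus1] transpose_def[of _ _ "_ :: nat"])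
          (auto simp: algebra_simps power2_eq_square)
    qed (intro G.m_closed aut 3)+
  qed
qed
lemma gassner_braid_action:
  "braid_action (module_aut (laurent_ring n) (tensor_module n)) n (gassner_gen n)"
proof -
  let ?G = "module_aut (laurent_ring n) (tensor_module n)"
  interpret G: group ?G by (intro module_aut_group free_module_module)
  note aut = local_operator.aut[OF gassner_gen_local]
  note ap = local_operator.F_apply[OF gassner_gen_local]
  note cl = local_operator.F_closed[OF gassner_gen_local]
  show ?thesis
  proof (unfold_locales, goal_cases)
    case (1 k)
    then show ?case by (rule aut)
  next
    case (2 i j)
    note [simp] = aut[OF 2(1)] aut[OF 2(2)]
    show ?case
    proof (rule module_aut_eqI)
      fix x \<tau> l assume x: "x \<in> carrier (tensor_module n)" and \<tau>: "\<tau> \<in> carrier (sym_group n)"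
      note [simp] = transpose_sym_group[OF 2(1)] transpose_sym_group[OF 2(2)]
      show "(gassner_gen n i \<otimes>\<^bsub>?G\<^esub> gassner_gen n j) x (\<tau>, l) = (gassner_gen n j \<otimes>\<^bsub>?G\<^esub> gassner_gen n i) x (\<tau>, l)"
        using 2(3) \<tau>
        by (simp del: One_nat_def add_Suc_right add: module_aut_apply_mult x cl[OF 2(1)] cl[OF 2(2)]
              ap[OF 2(1)] ap[OF 2(2)] inv_transpose_comp[of _ n] transpose_far[OF 2(3)] transpose_def[of _ _ "_ :: nat"])
    qed (intro G.m_closed aut 2)+
  next
    case (3 k)
    note [simp] = aut[OF 3(1)] aut[OF 3(2)]
    show ?case
    proof (rule module_aut_eqI)
      fix x \<tau> l assume x: "x \<in> carrier (tensor_module n)" and \<tau>: "\<tau> \<in> carrier (sym_group n)"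
      note [simp] = transpose_sym_group[OF 3(1), folded Suc_eq_plus1] transpose_sym_group[OF 3(2), folded Suc_eq_plus1]
      show "(gassner_gen n k \<otimes>\<^bsub>?G\<^esub> gassner_gen n (Suc k) \<otimes>\<^bsub>?G\<^esub> gassner_gen n k) x (\<tau>, l) =
        (gassner_gen n (Suc k) \<otimes>\<^bsub>?G\<^esub> gassner_gen n k \<otimes>\<^bsub>?G\<^esub> gassner_gen n (Suc k)) x (\<tau>, l)"
        using \<tau>
        by (simp del: One_nat_def add_Suc_right add: module_aut_apply_mult x cl[OF 3(1)] cl[OF 3(2)]
              ap[OF 3(1), folded Suc_eq_plus1] ap[OF 3(2), folded Suc_eq_plus1] inv_transpose_comp[of _ n] transpose_braid[folded Suc_eq_plus1] transpose_def[of _ _ "_ :: nat"])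
          (auto simp: algebra_simps power2_eq_square)
    qed (intro G.m_closed aut 3)+
  qed
qed

lemma quant_hom:
  "quant n \<in> hom (braid_group n) (module_aut (laurent_ring n) (tensor_module n))"
  unfolding quant_def by (rule braid_action.braid_extension_hom[OF quant_braid_action])

lemma quant_artin_gen: "k \<in> {1..<n} \<Longrightarrow> quant n (artin_gen n k) = quant_gen n k"
  unfolding quant_def by (rule braid_action.braid_extension_gen[OF quant_braid_action])

lemma gassner_hom:
  "gassner n \<in> hom (braid_group n) (module_aut (laurent_ring n) (tensor_module n))"
  unfolding gassner_def by (rule braid_action.braid_extension_hom[OF gassner_braid_action])

lemma gassner_artin_gen: "k \<in> {1..<n} \<Longrightarrow> gassner n (artin_gen n k) = gassner_gen n k"
  unfolding gassner_def by (rule braid_action.braid_extension_gen[OF gassner_braid_action])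

lemma quant_gen_tensor:
  assumes k: "k \<in> {1..<n}" and \<tau>: "\<tau> \<in> carrier (sym_group n)"
  defines "\<tau>' \<equiv> transpose k (k + 1) \<circ> \<tau>"
  shows "quant_gen n k (basis_vec \<tau> \<boxtimes> basis_vec k) =
      ((1 - svar (inv' \<tau> k) ^ 2) \<odot>\<^bsub>tensor_module n\<^esub> (basis_vec \<tau>' \<boxtimes> basis_vec k))
        \<oplus>\<^bsub>tensor_module n\<^esub>
      (svar (inv' \<tau> (k + 1)) \<odot>\<^bsub>tensor_module n\<^esub> (basis_vec \<tau>' \<boxtimes> basis_vec (k + 1)))"
    and "quant_gen n k (basis_vec \<tau> \<boxtimes> basis_vec (k + 1)) =
      svar (inv' \<tau> k) \<odot>\<^bsub>tensor_module n\<^esub> (basis_vec \<tau>' \<boxtimes> basis_vec k)"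
    and "i \<in> {1..n} - {k, k + 1} \<Longrightarrow>
      quant_gen n k (basis_vec \<tau> \<boxtimes> basis_vec i) = basis_vec \<tau>' \<boxtimes> basis_vec i"
proof -
  have "k \<in> {1..n}" "k + 1 \<in> {1..n}" using k by auto
  note [simp] = this[THEN linear_extension_tensor[OF \<tau>]]
  show "quant_gen n k (basis_vec \<tau> \<boxtimes> basis_vec k) =
      ((1 - svar (inv' \<tau> k) ^ 2) \<odot>\<^bsub>tensor_module n\<^esub> (basis_vec \<tau>' \<boxtimes> basis_vec k))
        \<oplus>\<^bsub>tensor_module n\<^esub>
      (svar (inv' \<tau> (k + 1)) \<odot>\<^bsub>tensor_module n\<^esub> (basis_vec \<tau>' \<boxtimes> basis_vec (k + 1)))"
    "quant_gen n k (basis_vec \<tau> \<boxtimes> basis_vec (k + 1)) =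
      svar (inv' \<tau> k) \<odot>\<^bsub>tensor_module n\<^esub> (basis_vec \<tau>' \<boxtimes> basis_vec k)"
    by (simp_all add: quant_gen_def \<tau>'_def Let_def del: One_nat_def add_Suc_right)
  assume "i \<in> {1..n} - {k, k + 1}"
  then show "quant_gen n k (basis_vec \<tau> \<boxtimes> basis_vec i) = basis_vec \<tau>' \<boxtimes> basis_vec i"
    using linear_extension_tensor[OF \<tau>, of i] by (simp add: quant_gen_def \<tau>'_def Let_def)
qed

lemma gassner_gen_tensor:
  assumes k: "k \<in> {1..<n}" and \<tau>: "\<tau> \<in> carrier (sym_group n)" and v: "v \<in> carrier (free_module n {1..n})"
  shows "gassner_gen n k (basis_vec \<tau> \<boxtimes> v) =
    basis_vec (transpose k (k + 1) \<circ> \<tau>) \<boxtimes> apply_matrix n (U_matrix k (tvar (inv' \<tau> (k + 1)))) v"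
proof (rule ext, clarify)
  fix \<pi> :: "nat \<Rightarrow> nat" and i :: nat
  let ?\<tau> = "transpose k (k + 1) \<circ> \<pi>"
  have x: "basis_vec \<tau> \<boxtimes> v \<in> carrier (tensor_module n)"
    using v \<tau> free_module_closed[OF v] by (auto simp: free_module_carrier tensor_def basis_vec_def)
  have eq: "?\<tau> = \<tau> \<longleftrightarrow> \<pi> = transpose k (k + 1) \<circ> \<tau>"
    by (auto simp flip: comp_assoc)
  have v0: "v j = 0" if "j \<notin> {1..n}" for j
    using v that unfolding free_module_carrier by blast
  have "apply_matrix n (U_matrix k t) v i =
      (if i = k then (1 - t) * v k + v (k + 1) else if i = k + 1 then t * v k else v i)" for t
  proof (cases "i \<in> {1..n}")
    case True
    have "U_matrix k t = local_matrix k (1 - t) 1 t"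
      by (auto simp: U_matrix_def local_matrix_def fun_eq_iff)
    then show ?thesis
      using True local_matrix_sum[OF k True, of v "1 - t" 1 t]
      by (simp add: apply_matrix_def mult.commute)
  next
    case False
    then have "i \<noteq> k \<and> i \<noteq> k + 1" using k by auto
    then show ?thesis using v0[OF False] False by (auto simp: apply_matrix_def)
  qed
  then show "gassner_gen n k (basis_vec \<tau> \<boxtimes> v) (\<pi>, i) =
    (basis_vec (transpose k (k + 1) \<circ> \<tau>) \<boxtimes> apply_matrix n (U_matrix k (tvar (inv' \<tau> (k + 1)))) v) (\<pi>, i)"
    unfolding local_operator.F_apply[OF gassner_gen_local[OF k] x]
    by (auto simp: tensor_def basis_vec_def eq simp flip: comp_assoc)
qed

lemma Phi_hom: "Phi n \<in> module_hom (laurent_ring n) (tensor_module n) (tensor_module n)"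
  unfolding Phi_def
proof (rule linear_extension_hom)
  fix \<tau> i assume *: "\<tau> \<in> carrier (sym_group n)" "i \<in> {1..n}"
  interpret module "laurent_ring n" "tensor_module n" by (rule free_module_module)
  have mem: "inv' \<tau> j \<in> {1..n}" if "j \<in> {i..n}" for j
    using that * by (intro inv_sym_group_mem) auto
  have "svar (inv' \<tau> i) \<in> carrier (laurent_ring n)"
    using * by (intro svar_closed mem) auto
  moreover have "inv\<^bsub>laurent_ring n\<^esub> (\<Prod>j = i..n. svar (inv' \<tau> j)) = (\<Prod>j = i..n. svar_inv (inv' \<tau> j))"
    using mem by (rule inv_prod_svar)
  moreover have "(\<Prod>j = i..n. svar_inv (inv' \<tau> j)) \<in> carrier (laurent_ring n)"
    by (intro laurent_prod_closed svar_inv_closed mem)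
  ultimately have "(1 - svar (inv' \<tau> i) ^ 2) * inv\<^bsub>laurent_ring n\<^esub> (\<Prod>j = i..n. svar (inv' \<tau> j))
      \<in> carrier (laurent_ring n)"
    by simp
  moreover have "basis_vec \<tau> \<boxtimes> basis_vec i \<in> carrier (tensor_module n)"
    using * unfolding free_module_carrier basis_vec_tensor by (simp add: basis_vec_def)
  ultimately show "((1 - svar (inv' \<tau> i) ^ 2) * inv\<^bsub>laurent_ring n\<^esub> (\<Prod>j = i..n. svar (inv' \<tau> j)))
      \<odot>\<^bsub>tensor_module n\<^esub> (basis_vec \<tau> \<boxtimes> basis_vec i) \<in> carrier (tensor_module n)"
    by (rule smult_closed)
qed

lemma Phi_tensor:
  assumes "\<tau> \<in> carrier (sym_group n)" "i \<in> {1..n}"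
  shows "Phi n (basis_vec \<tau> \<boxtimes> basis_vec i) =
    ((1 - svar (inv' \<tau> i) ^ 2) * inv\<^bsub>laurent_ring n\<^esub> (\<Prod>j = i..n. svar (inv' \<tau> j)))
      \<odot>\<^bsub>tensor_module n\<^esub> (basis_vec \<tau> \<boxtimes> basis_vec i)"
  unfolding Phi_def by (rule linear_extension_tensor[OF assms])

end

theory Submission
  imports Defs
begin

text \<open>
  The map \<open>\<Phi>\<close> is diagonal in the tensor basis. On the block of \<open>\<sigma>\<^sub>k\<close> at \<open>\<tau>\<close>, with
  \<open>a = s\<^bsub>\<tau>\<^sup>-\<^sup>1(k)\<^esub>\<close>, \<open>b = s\<^bsub>\<tau>\<^sup>-\<^sup>1(k+1)\<^esub>\<close> and \<open>P\<close> the product of the later \<open>s\<close>'s, its entries are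
  \<open>(1 - a\<^sup>2) / (a b P)\<close> and \<open>(1 - b\<^sup>2) / (b P)\<close>; at \<open>(k, k+1) \<tau>\<close> the roles of \<open>a\<close> and \<open>b\<close>
  are exchanged, and elsewhere the entries agree because the products of the \<open>s\<close>'s do. So \<open>\<Phi>\<close>
  intertwines the generators by a two-by-two computation, and being an intertwiner is preserved
  under composition and inverses of automorphisms.
\<close>

lemma module_aut_closed:
  "f \<in> carrier (module_aut R M) \<Longrightarrow> x \<in> carrier M \<Longrightarrow> f x \<in> carrier M"
  by (auto simp: module_aut_def module_hom_def)

lemma module_aut_one_apply: "x \<in> carrier M \<Longrightarrow> \<one>\<^bsub>module_aut R M\<^esub> x = x"
  by (simp add: module_aut_def BijGroup_def)

text \<open>Evaluate \<open>eq\<close> at the preimage of \<open>x\<close> under \<open>f\<close>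
  and cancel \<open>g\<close>. Only \<open>f\<close> and \<open>g\<close> are inverted, never
  \<open>\<Phi>\<close>: the map \<open>Phi\<close> is not invertible, since 1 - s^2 is not a
  unit.\<close>

lemma module_aut_inv_intertwines:
  assumes "group (module_aut R M)" "group (module_aut R N)"
    and f: "f \<in> carrier (module_aut R M)" and g: "g \<in> carrier (module_aut R N)"
    and \<Phi>: "\<And>x. x \<in> carrier M \<Longrightarrow> \<Phi> x \<in> carrier N"
    and eq: "\<And>x. x \<in> carrier M \<Longrightarrow> g (\<Phi> x) = \<Phi> (f x)"
    and x: "x \<in> carrier M"
  shows "(inv\<^bsub>module_aut R N\<^esub> g) (\<Phi> x) = \<Phi> ((inv\<^bsub>module_aut R M\<^esub> f) x)"
proof -
  interpret A: group "module_aut R M" by fact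
  interpret B: group "module_aut R N" by fact
  let ?y = "(inv\<^bsub>module_aut R M\<^esub> f) x"
  have y: "?y \<in> carrier M" using A.inv_closed[OF f] x by (rule module_aut_closed)
  have "f ?y = x"
    using module_aut_apply_mult[OF f A.inv_closed[OF f] x] f x by (simp add: module_aut_one_apply)
  then have "(inv\<^bsub>module_aut R N\<^esub> g) (\<Phi> x) = (inv\<^bsub>module_aut R N\<^esub> g) (g (\<Phi> ?y))"
    using eq[OF y] by simp
  also have "\<dots> = \<Phi> ?y"
    using module_aut_apply_mult[OF B.inv_closed[OF g] g \<Phi>[OF y]] g \<Phi>[OF y]
    by (simp add: module_aut_one_apply)
  finally show ?thesis .
qed

text \<open>Both extensions can be computed on one word representing \<open>\<alpha>\<close>, so
  induction on words reduces the claim to single letters; a negative letter is covered by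
  \<open>module_aut_inv_intertwines\<close>.\<close>

lemma braid_extension_intertwines:
  assumes f: "braid_action (module_aut R M) n f" and g: "braid_action (module_aut R N) n g"
    and \<Phi>: "\<And>x. x \<in> carrier M \<Longrightarrow> \<Phi> x \<in> carrier N"
    and eq: "\<And>k x. k \<in> {1..<n} \<Longrightarrow> x \<in> carrier M \<Longrightarrow> g k (\<Phi> x) = \<Phi> (f k x)"
    and \<alpha>: "\<alpha> \<in> carrier (braid_group n)" and x: "x \<in> carrier M"
  shows "braid_extension (module_aut R N) g \<alpha> (\<Phi> x) = \<Phi> (braid_extension (module_aut R M) f \<alpha> x)"
proof -
  interpret A: braid_action "module_aut R M" n f by fact
  interpret B: braid_action "module_aut R N" n g by fact
  have "eval_word (module_aut R N) g w (\<Phi> x) = \<Phi> (eval_word (module_aut R M) f w x)"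
    if "w \<in> braid_words n" for w
    using that
  proof (induction w)
    case Nil
    then show ?case using x \<Phi> by (simp add: module_aut_one_apply)
  next
    case (Cons l w)
    obtain k e where l: "l = (k, e)" by (cases l)
    from Cons.prems l have k: "k \<in> {1..<n}" and w: "w \<in> braid_words n" by auto
    let ?f = "if e then f k else inv\<^bsub>module_aut R M\<^esub> (f k)"
    let ?g = "if e then g k else inv\<^bsub>module_aut R N\<^esub> (g k)"
    have aut: "?f \<in> carrier (module_aut R M)" "?g \<in> carrier (module_aut R N)"
      using A.closed[OF k] B.closed[OF k] by auto
    have letter: "?g (\<Phi> y) = \<Phi> (?f y)" if "y \<in> carrier M" for y
    proof (cases e)
      case False
      have "(inv\<^bsub>module_aut R N\<^esub> (g k)) (\<Phi> y) = \<Phi> ((inv\<^bsub>module_aut R M\<^esub> (f k)) y)"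
        by (rule module_aut_inv_intertwines)
          (fact A.is_group B.is_group A.closed[OF k] B.closed[OF k] \<Phi> eq[OF k] that)+
      with False show ?thesis by simp
    qed (simp add: eq[OF k that])
    \<comment> \<open>The first letter acts last, so the tail is moved past \<open>\<Phi>\<close>
      first, and \<open>letter\<close> is then used at the image of \<open>x\<close> under the
      tail.\<close>
    show ?case
      using module_aut_apply_mult[OF aut(1) A.eval_closed[OF w] x]
        module_aut_apply_mult[OF aut(2) B.eval_closed[OF w] \<Phi>[OF x]]
        letter[OF module_aut_closed[OF A.eval_closed[OF w] x]] Cons.IH[OF w]
      by (simp add: l)
  qed
  moreover obtain w where "w \<in> braid_words n" "\<alpha> = braid_rel n `` {w}"
    using \<alpha> by (rule braid_group_carrierE)
  ultimately show ?thesis by (simp add: A.extension_class B.extension_class)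
qed

text \<open>The ring inverse from \<open>Phi\<close> is written as an explicit product, which can be
  split and reindexed factor by factor.\<close>

definition Phi_coeff :: "nat \<Rightarrow> (nat \<Rightarrow> nat) \<Rightarrow> nat \<Rightarrow> laurent" where
  "Phi_coeff n \<tau> i = (1 - svar (inv' \<tau> i) ^ 2) * (\<Prod>j = i..n. svar_inv (inv' \<tau> j))"

lemma Phi_closed: "x \<in> carrier (tensor_module n) \<Longrightarrow> Phi n x \<in> carrier (tensor_module n)"
  using Phi_hom unfolding module_hom_def by blast

text \<open>On the tensor basis only one term of the defining sum survives; off it both sides
  vanish.\<close>

lemma Phi_apply:
  assumes x: "x \<in> carrier (tensor_module n)"
  shows "Phi n x (\<tau>, i) = Phi_coeff n \<tau> i * x (\<tau>, i)"
proof (cases "(\<tau>, i) \<in> tensor_basis n")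
  case False
  then show ?thesis using x Phi_closed[OF x] unfolding free_module_carrier by auto
next
  case True
  have "Phi n x (\<tau>, i) = (\<Sum>c\<in>tensor_basis n. if c = (\<tau>, i) then Phi_coeff n \<tau> i * x (\<tau>, i) else 0)"
  proof -
    have "inv\<^bsub>laurent_ring n\<^esub> (\<Prod>j = l..n. svar (inv' \<pi> j)) = (\<Prod>j = l..n. svar_inv (inv' \<pi> j))"
      if "\<pi> \<in> carrier (sym_group n)" "l \<in> {1..n}" for \<pi> l
      using that by (intro inv_prod_svar inv_sym_group_mem) auto
    then show ?thesis
      using x unfolding Phi_def linear_extension_def basis_vec_tensor
      by (auto simp: basis_vec_def Phi_coeff_def mult.commute intro!: sum.cong)
  qed
  also have "\<dots> = Phi_coeff n \<tau> i * x (\<tau>, i)"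
    using True finite_tensor_basis by (subst sum.delta) auto
  finally show ?thesis .
qed

text \<open>For \<open>i \<le> k\<close> the transposition permutes \<open>{i..n}\<close> and merely
  reindexes the product; for \<open>i > k + 1\<close> it fixes every index. At
  \<open>i = k + 1\<close> the range separates \<open>k\<close> from \<open>k + 1\<close>.\<close>

lemma prod_transpose_comp:
  fixes k :: nat
  assumes \<tau>: "\<tau> \<in> carrier (sym_group n)" and k: "k \<in> {1..<n}" and i: "i \<noteq> k + 1"
  shows "(\<Prod>j = i..n. h (inv' (transpose k (k + 1) \<circ> \<tau>) j)) = (\<Prod>j = i..n. h (inv' \<tau> j))"
proof (cases "i \<le> k")
  case True
  then have "bij_betw (transpose k (k + 1)) {i..n} {i..n}"
    using k by (intro permutes_imp_bij permutes_swap_id) auto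
  from prod.reindex_bij_betw[OF this, of "\<lambda>j. h (inv' \<tau> j)"] show ?thesis
    by (simp only: inv_transpose_comp[OF \<tau>])
next
  case False
  then show ?thesis
    using i by (intro prod.cong) (auto simp: inv_transpose_comp[OF \<tau>] transpose_def)
qed

lemma Phi_intertwines_gen:
  assumes k: "k \<in> {1..<n}" and x: "x \<in> carrier (tensor_module n)"
  shows "gassner_gen n k (Phi n x) = Phi n (quant_gen n k x)"
proof (rule ext, clarify)
  fix \<pi> :: "nat \<Rightarrow> nat" and i :: nat
  \<comment> \<open>The generator carries the component at \<open>\<tau>\<close> to
    \<open>\<pi>\<close>, so coefficients of images at \<open>\<pi>\<close> are read off from
    \<open>x\<close> at \<open>\<tau>\<close>.\<close>
  define \<tau> where "\<tau> = transpose k (k + 1) \<circ> \<pi>"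
  note quant_closed = local_operator.F_closed[OF quant_gen_local[OF k] x]
  note gassner_closed = local_operator.F_closed[OF gassner_gen_local[OF k] Phi_closed[OF x]]
  show "gassner_gen n k (Phi n x) (\<pi>, i) = Phi n (quant_gen n k x) (\<pi>, i)"
  proof (cases "\<pi> \<in> carrier (sym_group n)")
    case False
    then show ?thesis
      using Phi_closed[OF quant_closed] gassner_closed unfolding free_module_carrier by auto
  next
    case True
    then have \<tau>: "\<tau> \<in> carrier (sym_group n)"
      unfolding \<tau>_def using transpose_sym_group[OF k] by blast
    have \<pi>: "\<pi> = transpose k (k + 1) \<circ> \<tau>"
      by (simp add: \<tau>_def flip: comp_assoc)
    define a a' b b' where ab: "a = svar (inv' \<tau> k)" "a' = svar_inv (inv' \<tau> k)"
      "b = svar (inv' \<tau> (k + 1))" "b' = svar_inv (inv' \<tau> (k + 1))"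
    define W where "W = (\<Prod>j = k + 2..n. svar_inv (inv' \<tau> j))"
    have units: "a * a' = 1" "b * b' = 1" by (simp_all add: ab svar_mult_inv)
    have split_k: "(\<Prod>j = k..n. h j) = h k * (h (k + 1) * (\<Prod>j = k + 2..n. h j))"
      and split_Suc: "(\<Prod>j = k + 1..n. h j) = h (k + 1) * (\<Prod>j = k + 2..n. h j)" for h :: "nat \<Rightarrow> laurent"
      using k by (simp_all add: prod.atLeast_Suc_atMost)
    have inv_\<pi>: "inv' \<pi> j = inv' \<tau> (transpose k (k + 1) j)" for j
      unfolding \<pi> by (rule inv_transpose_comp[OF \<tau>])
    have W_\<pi>: "(\<Prod>j = k + 2..n. svar_inv (inv' \<pi> j)) = W"
      unfolding W_def \<pi> by (rule prod_transpose_comp[OF \<tau> k]) simp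
    have c: "Phi_coeff n \<tau> k = (1 - a ^ 2) * (a' * (b' * W))"
      "Phi_coeff n \<tau> (k + 1) = (1 - b ^ 2) * (b' * W)"
      "Phi_coeff n \<pi> k = (1 - b ^ 2) * (b' * (a' * W))"
      "Phi_coeff n \<pi> (k + 1) = (1 - a ^ 2) * (a' * W)"
      unfolding Phi_coeff_def split_k split_Suc W_\<pi>
      by (simp_all add: inv_\<pi> ab W_def del: One_nat_def add_Suc_right)
    have c_other: "Phi_coeff n \<pi> i = Phi_coeff n \<tau> i" if "i \<noteq> k" "i \<noteq> k + 1"
      using prod_transpose_comp[OF \<tau> k that(2), of svar_inv] that
      unfolding Phi_coeff_def \<pi> by (simp add: inv_transpose_comp[OF \<tau>])
    have at_k: "(1 - b ^ 2) * (Phi_coeff n \<tau> k * y) + Phi_coeff n \<tau> (k + 1) * z =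
        Phi_coeff n \<pi> k * ((1 - a ^ 2) * y + a * z)" for y z
    proof -
      \<comment> \<open>The coefficients of \<open>y\<close> agree at once; those of
        \<open>z\<close> differ by the factor \<open>a * a'\<close>, which is inserted here so that
        \<open>algebra_simps\<close> suffices.\<close>
      have rescaled: "Phi_coeff n \<tau> (k + 1) = (a * a') * ((1 - b ^ 2) * (b' * W))"
        by (simp only: c units mult_1)
      show ?thesis unfolding rescaled c(1,3) by (simp add: algebra_simps)
    qed
    have at_Suc: "b ^ 2 * (Phi_coeff n \<tau> k * y) = Phi_coeff n \<pi> (k + 1) * (b * y)" for y
    proof -
      have "b ^ 2 * (Phi_coeff n \<tau> k * y) = (b * b') * ((1 - a ^ 2) * (a' * W) * (b * y))"
        by (simp add: c power2_eq_square algebra_simps)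
      then show ?thesis by (simp only: c units mult_1)
    qed
    show ?thesis
      unfolding local_operator.F_apply[OF gassner_gen_local[OF k] Phi_closed[OF x]]
        Phi_apply[OF quant_closed] local_operator.F_apply[OF quant_gen_local[OF k] x]
        Phi_apply[OF x] \<tau>_def[symmetric] tvar_def ab(1,3)[symmetric]
      using at_k at_Suc c_other by simp
  qed
qed

theorem theorem2p25:
  fixes n :: nat
  assumes "n \<ge> 2"
  shows "\<forall>\<alpha>\<in>carrier (braid_group n).
    compose (carrier (tensor_module n)) (gassner n \<alpha>) (Phi n) =
    compose (carrier (tensor_module n)) (Phi n) (quant n \<alpha>)"
proof
  fix \<alpha> assume \<alpha>: "\<alpha> \<in> carrier (braid_group n)"
  have "gassner n \<alpha> (Phi n x) = Phi n (quant n \<alpha> x)" if "x \<in> carrier (tensor_module n)" for x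
    unfolding gassner_def quant_def
    by (rule braid_extension_intertwines[where \<Phi> = "Phi n"])
      (fact quant_braid_action gassner_braid_action Phi_closed Phi_intertwines_gen \<alpha> that)+
  \<comment> \<open>\<open>compose\<close> restricts both sides to the carrier, so agreement there
    gives equality of maps.\<close>
  then show "compose (carrier (tensor_module n)) (gassner n \<alpha>) (Phi n) =
      compose (carrier (tensor_module n)) (Phi n) (quant n \<alpha>)"
    by (auto simp: compose_def)
qed

end
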